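(* Let $B$ be the commutative ring \[ B = \frac{R\left[b_{i,j} \mid i \in [1,r],\ j \in \mathbb{Z} \right]}{\left(b_{i,j}^2 - \sigma^{-j}((z - \alpha_i)^{n_i}) \mid i \in [1,r],\ j \in \mathbb{Z} \right)} \] associated with $(R,\sigma,f)$ as described in the context. Then the Krull dimension of $B$ is one.
   Context: $\Bbbk$ is an algebraically closed field of characteristic zero. Either (1) $R=\Bbbk[z]$ and $\sigma$ is the automorphism $\sigma(z)=z+1$, or (2) $R=\Bbbk[z,z^{-1}]$ and $\sigma(z)=\xi z$ with $\xi\in\Bbbk^\times$ not a root of unity. $f\in\Bbbk[z]$ is monic with $f(0)\ne0$ in case (2). Put $\sigma_\Bbbk(\lambda)=\lambda-1$ in case (1), $\sigma_\Bbbk(\lambda)=\xi^{-1}\lambda$ in case (2); no two distinct roots of $f$ lie on the same $\sigma_\Bbbk$-orbit. $\alpha_1,\dots,\alpha_r$ are the distinct roots of $f$, with multiplicities $n_1,\dots,n_r$. $[1,r]=\{1,\dots,r\}$. *)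

theory Defs
  imports
    "HOL-Algebra.Algebraic_Closure_Type"
    "HOL-Algebra.QuotRing"
    "HOL-Computational_Algebra.Polynomial"
    "HOL-Library.Poly_Mapping"
    "HOL-Library.Extended_Nat"
begin

section \<open>Krull dimension\<close>

text \<open>The supremum of the lengths \<open>n\<close> of strict chains
  \<open>P 0 \<subset> \<dots> \<subset> P n\<close> of prime ideals.  With values in \<^typ>\<open>enat\<close> the zero ring gets
  dimension \<open>0\<close> instead of the customary \<open>-\<infinity>\<close>; this does not affect whether the
  dimension equals \<open>1\<close>.\<close>

definition krull_dim :: "('a, 'm) ring_scheme \<Rightarrow> enat" where
  "krull_dim A = Sup {enat n | n. \<exists>P :: nat \<Rightarrow> 'a set.
     (\<forall>i\<le>n. primeideal (P i) A) \<and> (\<forall>i<n. P i \<subset> P (Suc i))}"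


section \<open>Polynomial rings in arbitrarily many variables\<close>

text \<open>Monomials are finitely supported exponent functions, polynomials are finitely supported
  coefficient functions on monomials; multiplication is the convolution product of
  \<open>Poly_Mapping\<close>.  \<open>mpoly_ring V\<close> is the ring of those polynomials in which only
  variables from \<open>V\<close> occur.\<close>

type_synonym ('v, 'r) mpoly = "('v \<Rightarrow>\<^sub>0 nat) \<Rightarrow>\<^sub>0 'r"

definition mpoly_var :: "'v \<Rightarrow> ('v, 'r::comm_ring_1) mpoly" where
  "mpoly_var v = Poly_Mapping.single (Poly_Mapping.single v 1) 1"

definition mpoly_const :: "'r::comm_ring_1 \<Rightarrow> ('v, 'r) mpoly" where
  "mpoly_const c = Poly_Mapping.single 0 c"

definition mpoly_ring :: "'v set \<Rightarrow> ('v, 'r::comm_ring_1) mpoly ring" where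
  "mpoly_ring V = ring_of_type_algebra
     \<lparr>carrier := {p. \<forall>m \<in> Poly_Mapping.keys p. Poly_Mapping.keys m \<subseteq> V}\<rparr>"

lemma cring_mpoly_ring: "cring (mpoly_ring V :: ('v, 'r::comm_ring_1) mpoly ring)"
proof -
  have add: "Poly_Mapping.keys m \<subseteq> V"
    if "\<forall>m \<in> Poly_Mapping.keys p. Poly_Mapping.keys m \<subseteq> V"
      "\<forall>m \<in> Poly_Mapping.keys q. Poly_Mapping.keys m \<subseteq> V" "m \<in> Poly_Mapping.keys (p + q)"
    for p q :: "('v, 'r) mpoly" and m
    using that Poly_Mapping.keys_add[of p q] by blast
  have mult: "Poly_Mapping.keys m \<subseteq> V"
    if p: "\<forall>m \<in> Poly_Mapping.keys p. Poly_Mapping.keys m \<subseteq> V"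
      and q: "\<forall>m \<in> Poly_Mapping.keys q. Poly_Mapping.keys m \<subseteq> V"
      and m: "m \<in> Poly_Mapping.keys (p * q)"
    for p q :: "('v, 'r) mpoly" and m
  proof -
    from m keys_mult[of p q] obtain a b where
      "m = a + b" "a \<in> Poly_Mapping.keys p" "b \<in> Poly_Mapping.keys q" by blast
    with p q Poly_Mapping.keys_add[of a b] show ?thesis by blast
  qed
  show ?thesis
  proof (rule cringI)
    show "abelian_group (mpoly_ring V :: ('v, 'r) mpoly ring)"
    proof (rule abelian_groupI)
      fix x :: "('v, 'r) mpoly"
      assume "x \<in> carrier (mpoly_ring V)"
      then show "\<exists>y \<in> carrier (mpoly_ring V). y \<oplus>\<^bsub>mpoly_ring V\<^esub> x = \<zero>\<^bsub>mpoly_ring V\<^esub>"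
        by (intro bexI[of _ "- x"]) (auto simp: mpoly_ring_def ring_of_type_algebra_def)
    qed (auto simp: mpoly_ring_def ring_of_type_algebra_def algebra_simps dest: add)
    show "comm_monoid (mpoly_ring V :: ('v, 'r) mpoly ring)"
      by (rule comm_monoidI)
        (auto simp: mpoly_ring_def ring_of_type_algebra_def algebra_simps dest: mult)
  qed (auto simp: mpoly_ring_def ring_of_type_algebra_def algebra_simps)
qed


section \<open>Integer iterates, orbits and automorphisms\<close>

definition int_iterate :: "('a \<Rightarrow> 'a) \<Rightarrow> int \<Rightarrow> 'a \<Rightarrow> 'a" where
  "int_iterate \<tau> m = (if m \<ge> 0 then \<tau> ^^ nat m else inv_into UNIV \<tau> ^^ nat (- m))"

definition same_orbit :: "('a \<Rightarrow> 'a) \<Rightarrow> 'a \<Rightarrow> 'a \<Rightarrow> bool" where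
  "same_orbit \<tau> x y \<longleftrightarrow> (\<exists>m. int_iterate \<tau> m x = y)"

text \<open>Here \<open>\<iota>\<close> is the structure map of the algebra.\<close>

definition algebra_automorphism ::
    "('k::comm_ring_1 \<Rightarrow> 'r::comm_ring_1) \<Rightarrow> ('r \<Rightarrow> 'r) \<Rightarrow> bool" where
  "algebra_automorphism \<iota> \<sigma> \<longleftrightarrow> bij \<sigma> \<and> (\<forall>x y. \<sigma> (x + y) = \<sigma> x + \<sigma> y) \<and>
     (\<forall>x y. \<sigma> (x * y) = \<sigma> x * \<sigma> y) \<and> (\<forall>c. \<sigma> (\<iota> c) = \<iota> c)"


section \<open>The base rings\<close>

abbreviation poly_z :: "'k::comm_ring_1 poly" where
  "poly_z \<equiv> [:0, 1:]"

abbreviation poly_const :: "'k::comm_ring_1 \<Rightarrow> 'k poly" where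
  "poly_const c \<equiv> [:c:]"

type_synonym 'k laurent = "int \<Rightarrow>\<^sub>0 'k"

abbreviation laurent_z :: "'k::comm_ring_1 laurent" where
  "laurent_z \<equiv> Poly_Mapping.single 1 1"

abbreviation laurent_const :: "'k::comm_ring_1 \<Rightarrow> 'k laurent" where
  "laurent_const c \<equiv> Poly_Mapping.single 0 c"

text \<open>The prescribed automorphisms exist.\<close>

lemma poly_shift_automorphism:
  "algebra_automorphism poly_const (\<lambda>p :: 'k::comm_ring_1 poly. pcompose p [:1, 1:])"
  "pcompose poly_z [:1, 1:] = poly_z + (1 :: 'k::comm_ring_1 poly)"
proof -
  have "bij (\<lambda>p :: 'k poly. pcompose p [:1, 1:])"
    by (rule o_bij[where g = "\<lambda>p. pcompose p [:-1, 1:]"])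
      (auto simp: fun_eq_iff pcompose_assoc[symmetric] pcompose_pCons pcompose_idR)
  then show "algebra_automorphism poly_const (\<lambda>p :: 'k poly. pcompose p [:1, 1:])"
    by (simp add: algebra_automorphism_def pcompose_add pcompose_mult)
  show "pcompose poly_z [:1, 1:] = poly_z + (1 :: 'k poly)"
    by (simp add: pcompose_pCons one_pCons)
qed

lemma laurent_scale_automorphism:
  fixes \<xi> :: "'k::field"
  assumes "\<xi> \<noteq> 0"
  defines "S \<equiv> \<lambda>a p. Poly_Mapping.mapp (\<lambda>n c. a powi n * c) p :: 'k laurent"
  shows "algebra_automorphism laurent_const (S \<xi>)"
    and "S \<xi> laurent_z = laurent_const \<xi> * laurent_z"
proof -
  have lookup: "Poly_Mapping.lookup (S a p) n = a powi n * Poly_Mapping.lookup p n" for a p n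
    by (auto simp: S_def lookup_mapp when_def in_keys_iff)
  have add: "S a (p + q) = S a p + S a q" for a p q
    by (rule poly_mapping_eqI) (simp add: lookup lookup_add algebra_simps)
  have single: "S a (Poly_Mapping.single n c) = Poly_Mapping.single n (a powi n * c)" for a n c
    by (rule poly_mapping_eqI) (simp add: lookup lookup_single when_def)
  have induct: "P p" if "\<And>n c. P (Poly_Mapping.single n c)" "\<And>p q. P p \<Longrightarrow> P q \<Longrightarrow> P (p + q)"
    for P and p :: "'k laurent"
  proof (induction p rule: update_induct)
    case const
    show ?case using that(1)[of 0 0] by simp
  next
    case (update p n c)
    have "Poly_Mapping.update n c p = Poly_Mapping.single n c + p"
      using update(1)
      by (intro poly_mapping_eqI)
        (auto simp: lookup_update lookup_add lookup_single when_def in_keys_iff)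
    then show ?case using that update by simp
  qed
  have mult1: "S \<xi> (Poly_Mapping.single n c * q) = S \<xi> (Poly_Mapping.single n c) * S \<xi> q" for n c q
  proof (rule induct[of _ q])
    show "S \<xi> (Poly_Mapping.single n c * Poly_Mapping.single m d) =
        S \<xi> (Poly_Mapping.single n c) * S \<xi> (Poly_Mapping.single m d)" for m d
      using assms(1) by (simp add: mult_single single power_int_add algebra_simps)
  qed (simp add: distrib_left add)
  have mult: "S \<xi> (p * q) = S \<xi> p * S \<xi> q" for p q
    by (rule induct[of _ p]) (simp_all add: mult1 distrib_right add)
  have "S a (S b p) = p" if "a * b = 1" for a b p
    by (rule poly_mapping_eqI)
      (simp add: lookup mult.assoc[symmetric] power_int_mult_distrib[symmetric] that)
  then have "bij (S \<xi>)"
    using assms(1) by (intro o_bij[where g = "S (inverse \<xi>)"]) (auto simp: fun_eq_iff)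
  then show "algebra_automorphism laurent_const (S \<xi>)"
    by (simp add: algebra_automorphism_def add mult single)
  show "S \<xi> laurent_z = laurent_const \<xi> * laurent_z"
    by (simp add: single mult_single)
qed


section \<open>The ring B\<close>

text \<open>The base ring \<open>R\<close> is the type \<open>'r\<close>, a \<open>'k\<close>-algebra via \<open>\<iota>\<close>, with distinguished
  element \<open>z\<close>.  The variable \<open>b\<^sub>i\<^sub>,\<^sub>j\<close> is indexed by the pair \<open>(i, j)\<close>.\<close>

definition B_relations ::
  "('k \<Rightarrow> 'r::comm_ring_1) \<Rightarrow> 'r \<Rightarrow> ('r \<Rightarrow> 'r) \<Rightarrow> nat \<Rightarrow> (nat \<Rightarrow> 'k) \<Rightarrow> (nat \<Rightarrow> nat)
    \<Rightarrow> (nat \<times> int, 'r) mpoly set" where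
  "B_relations \<iota> z \<sigma> r \<alpha> n =
     {mpoly_var (i, j) ^ 2 - mpoly_const (int_iterate \<sigma> (- j) ((z - \<iota> (\<alpha> i)) ^ n i))
       | i j. i \<in> {1..r}}"

definition B_ring ::
  "('k \<Rightarrow> 'r::comm_ring_1) \<Rightarrow> 'r \<Rightarrow> ('r \<Rightarrow> 'r) \<Rightarrow> nat \<Rightarrow> (nat \<Rightarrow> 'k) \<Rightarrow> (nat \<Rightarrow> nat)
    \<Rightarrow> (nat \<times> int, 'r) mpoly set ring" where
  "B_ring \<iota> z \<sigma> r \<alpha> n =
     mpoly_ring ({1..r} \<times> UNIV) Quot
       genideal (mpoly_ring ({1..r} \<times> UNIV)) (B_relations \<iota> z \<sigma> r \<alpha> n)"

end

theory Submission
  imports Defs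
begin

text \<open>
  Lower bound: over an algebraically closed field of characteristic zero every affine polynomial
  in \<open>1 + t\<^sup>2\<close> is a square in \<open>k[[t]]\<close>, a zero at \<open>t = 0\<close> being a double one.  Hence
  \<open>z \<mapsto> 1 + t\<^sup>2\<close> extends to a homomorphism \<open>B \<rightarrow> k[[t]]\<close>, and the preimages of \<open>0\<close> and of \<open>(t)\<close>
  are primes \<open>P \<subset> P'\<close>, separated by \<open>z - 1\<close>.

  Upper bound: strict inclusions of primes of \<open>B\<close> stay strict after intersecting with \<open>R\<close>.
  The variables \<open>b\<^sub>i\<^sub>j\<close> are removed one at a time by taking norms of \<open>p + q b\<^sub>i\<^sub>j\<close>.  In \<open>R\<close>, a
  localization of \<open>k[z]\<close>, a nonzero prime contains some \<open>z - c\<close> and is therefore maximal.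
\<close>

section \<open>Krull dimension one, and prime ideals of a quotient ring\<close>

text \<open>Excluding chains of length two bounds every length, since a longer chain begins with one
  of length two.\<close>

lemma krull_dim_eq_oneI:
  assumes "primeideal P A" "primeideal P' A" "P \<subset> P'"
    and no_chain: "\<And>P0 P1 P2. primeideal P0 A \<Longrightarrow> primeideal P1 A \<Longrightarrow> primeideal P2 A \<Longrightarrow>
      P0 \<subset> P1 \<Longrightarrow> P1 \<subset> P2 \<Longrightarrow> False"
  shows "krull_dim A = 1"
  unfolding krull_dim_def
proof (rule antisym)
  show "Sup {enat n | n. \<exists>P. (\<forall>i\<le>n. primeideal (P i) A) \<and> (\<forall>i<n. P i \<subset> P (Suc i))} \<le> 1"
  proof (rule Sup_least, clarify)
    fix n P
    assume P: "\<forall>i\<le>n. primeideal (P i) A" "\<forall>i<n. P i \<subset> P (Suc i)"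
    have "n \<le> 1"
    proof (rule ccontr)
      assume "\<not> n \<le> 1"
      then show False
        using no_chain[of "P 0" "P (Suc 0)" "P (Suc (Suc 0))"] P by simp
    qed
    then show "enat n \<le> 1" by (simp add: one_enat_def)
  qed
  have "\<exists>Q. (\<forall>i\<le>1::nat. primeideal (Q i) A) \<and> (\<forall>i<1. Q i \<subset> Q (Suc i))"
    using assms(1-3) by (intro exI[of _ "\<lambda>i. if i = 0 then P else P'"]) auto
  then show "1 \<le> Sup {enat n | n. \<exists>P. (\<forall>i\<le>n. primeideal (P i) A) \<and> (\<forall>i<n. P i \<subset> P (Suc i))}"
    unfolding one_enat_def by (intro Sup_upper) blast
qed

lemma (in cring) primeideal_quot:
  assumes "ideal I R" "primeideal P R" "I \<subseteq> P"
  shows "primeideal ((+>) I ` P) (R Quot I)"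
proof -
  interpret I: ideal I R by fact
  interpret P: primeideal P R by fact
  \<comment> \<open>As \<open>I\<close> lies in \<open>P\<close>, the set \<open>P\<close> is the
    union of the cosets of its elements, so \<open>a \<in> P\<close> can be read off from its coset.
    Properness and primality of the image both reduce to this.\<close>
  have mem: "a \<in> P" if a: "a \<in> carrier R" and "I +> a \<in> (+>) I ` P" for a
  proof -
    from that obtain p where p: "p \<in> P" "I +> a = I +> p" by blast
    have "a \<in> (\<Union>p\<in>P. I +> p)"
      using p I.a_rcos_self[OF a] by blast
    then show ?thesis
      using ideal_incl_iff[OF assms(1) P.is_ideal] assms(3) by blast
  qed
  show ?thesis
  proof (rule primeidealI)
    show "ideal ((+>) I ` P) (R Quot I)"
      by (rule ring_ideal_imp_quot_ideal[OF assms(1) P.is_ideal])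
    show "cring (R Quot I)" by (rule I.quotient_is_cring) (rule is_cring)
    show "carrier (R Quot I) \<noteq> (+>) I ` P"
    proof
      assume "carrier (R Quot I) = (+>) I ` P"
      then have "\<one> \<in> P"
        using mem[of \<one>] ring_hom_closed[OF I.rcos_ring_hom, of \<one>] by simp
      then show False using P.one_imp_carrier P.I_notcarr by blast
    qed
    fix A B
    assume A: "A \<in> carrier (R Quot I)" and B: "B \<in> carrier (R Quot I)"
      and AB: "A \<otimes>\<^bsub>R Quot I\<^esub> B \<in> (+>) I ` P"
    from A obtain x where x: "x \<in> carrier R" "A = I +> x"
      unfolding FactRing_def A_RCOSETS_def' by auto
    from B obtain y where y: "y \<in> carrier R" "B = I +> y"
      unfolding FactRing_def A_RCOSETS_def' by auto
    have "I +> (x \<otimes> y) \<in> (+>) I ` P"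
      using AB x y ring_hom_mult[OF I.rcos_ring_hom] by simp
    then have "x \<otimes> y \<in> P" by (rule mem[rotated]) (simp add: x(1) y(1))
    then have "x \<in> P \<or> y \<in> P" by (rule P.I_prime[OF x(1) y(1)])
    then show "A \<in> (+>) I ` P \<or> B \<in> (+>) I ` P" using x y by blast
  qed
qed

text \<open>Moves both bounds from the quotient to primes of \<open>R\<close> containing
  \<open>I\<close>: the pair \<open>P\<close>, \<open>P'\<close> is pushed forward along the
  quotient map, a hypothetical chain is pulled back.\<close>

lemma (in cring) krull_dim_quot_eq_oneI:
  assumes I: "ideal I R" and P: "primeideal P R" "primeideal P' R" "I \<subseteq> P" "P \<subset> P'"
    and no_chain: "\<And>P0 P1 P2. primeideal P0 R \<Longrightarrow> primeideal P1 R \<Longrightarrow> primeideal P2 R \<Longrightarrow>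
      I \<subseteq> P0 \<Longrightarrow> P0 \<subset> P1 \<Longrightarrow> P1 \<subset> P2 \<Longrightarrow> False"
  shows "krull_dim (R Quot I) = 1"
proof (rule krull_dim_eq_oneI)
  interpret I: ideal I R by fact
  note corr = quot_ideal_correspondence[OF I]
  have "ideal P R" "ideal P' R" "I \<subseteq> P'"
    using P by (auto simp: primeideal_def)
  then have "(+>) I ` P \<noteq> (+>) I ` P'"
    using inj_onD[OF bij_betw_imp_inj_on[OF corr], of P P'] P(3,4)
    by (metis (mono_tags, lifting) mem_Collect_eq psubset_eq)
  then show "(+>) I ` P \<subset> (+>) I ` P'" using P by blast
  show "primeideal ((+>) I ` P) (R Quot I)" "primeideal ((+>) I ` P') (R Quot I)"
    by (rule primeideal_quot[OF I P(1,3)], rule primeideal_quot[OF I P(2) \<open>I \<subseteq> P'\<close>])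
  let ?V = "\<lambda>Q. {r \<in> carrier R. I +> r \<in> Q}"
  fix Q0 Q1 Q2
  assume Q: "primeideal Q0 (R Quot I)" "primeideal Q1 (R Quot I)" "primeideal Q2 (R Quot I)"
    and less: "Q0 \<subset> Q1" "Q1 \<subset> Q2"
  have prime: "primeideal (?V Q) R" if "primeideal Q (R Quot I)" for Q
    by (rule ring_hom_ring.primeideal_vimage[OF I.rcos_ring_hom_ring is_cring that])
  \<comment> \<open>Preimages stay distinct because the quotient map is surjective.\<close>
  have strict: "?V Q \<subset> ?V Q'" if "primeideal Q' (R Quot I)" "Q \<subset> Q'" for Q Q'
  proof -
    from that obtain A where A: "A \<in> Q'" "A \<notin> Q" by blast
    moreover have "Q' \<subseteq> carrier (R Quot I)"
      using that by (meson additive_subgroup.a_subset ideal.axioms(1) primeideal_def)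
    ultimately obtain x where "x \<in> carrier R" "A = I +> x"
      unfolding FactRing_def A_RCOSETS_def' by auto
    with A that show ?thesis by blast
  qed
  have "I \<subseteq> ?V Q0"
  proof
    interpret Q0: primeideal Q0 "R Quot I" by (rule Q(1))
    fix i assume "i \<in> I"
    then show "i \<in> ?V Q0"
      using additive_subgroup.zero_closed[OF Q0.is_additive_subgroup] I.a_Hcarr I.a_rcos_const by (simp add: FactRing_def)
  qed
  then show False
    by (rule no_chain[OF prime[OF Q(1)] prime[OF Q(2)] prime[OF Q(3)] _
      strict[OF Q(2) less(1)] strict[OF Q(3) less(2)]])
qed

section \<open>Polynomial rings and evaluation homomorphisms\<close>

lemma carrier_mpoly_ring:
  "carrier (mpoly_ring V) = {p. \<forall>m \<in> Poly_Mapping.keys p. Poly_Mapping.keys m \<subseteq> V}"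
  by (simp add: mpoly_ring_def ring_of_type_algebra_def)

lemma mpoly_ring_simps [simp]:
  "x \<otimes>\<^bsub>mpoly_ring V\<^esub> y = x * y" "\<one>\<^bsub>mpoly_ring V\<^esub> = 1"
  "\<zero>\<^bsub>mpoly_ring V\<^esub> = 0" "x \<oplus>\<^bsub>mpoly_ring V\<^esub> y = x + y"
  by (simp_all add: mpoly_ring_def ring_of_type_algebra_def)

lemma ring_of_type_algebra_simps [simp]:
  "carrier ring_of_type_algebra = UNIV"
  "x \<otimes>\<^bsub>ring_of_type_algebra\<^esub> y = x * y" "\<one>\<^bsub>ring_of_type_algebra\<^esub> = 1"
  "\<zero>\<^bsub>ring_of_type_algebra\<^esub> = 0" "x \<oplus>\<^bsub>ring_of_type_algebra\<^esub> y = x + y"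
  by (simp_all add: ring_of_type_algebra_def)

locale ring_morphism =
  fixes h :: "'a::comm_ring_1 \<Rightarrow> 'b::comm_ring_1"
  assumes add: "h (x + y) = h x + h y"
    and mult: "h (x * y) = h x * h y"
    and one: "h 1 = 1"
begin

lemma zero: "h 0 = 0"
  using add[of 0 0] by simp

lemma minus: "h (- x) = - h x"
  using add[of x "- x"] zero by (simp add: eq_neg_iff_add_eq_0 add.commute)

lemma diff: "h (x - y) = h x - h y"
  using add[of x "- y"] minus by simp

lemma power: "h (x ^ n) = h x ^ n"
  by (induction n) (simp_all add: one mult)

end

lemma poly_mapping_single_induct [case_names single add]:
  fixes p :: "'a \<Rightarrow>\<^sub>0 'b::comm_monoid_add"
  assumes single: "\<And>m c. P (Poly_Mapping.single m c)"
    and add: "\<And>p q. P p \<Longrightarrow> P q \<Longrightarrow> P (p + q)"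
  shows "P p"
proof (induction p rule: update_induct)
  case const
  show ?case using single[of undefined 0] by simp
next
  case (update p m c)
  have "Poly_Mapping.update m c p = Poly_Mapping.single m c + p"
    using update(1)
    by (intro poly_mapping_eqI)
      (auto simp: lookup_update lookup_add lookup_single when_def in_keys_iff)
  then show ?case using update single add by simp
qed

text \<open>The universal map out of the monoid ring of \<open>'m\<close>, given by a coefficient
  map \<open>\<phi>\<close> and a character \<open>\<chi>\<close>. It evaluates polynomials when
  \<open>'m\<close> consists of monomials, and Laurent polynomials when \<open>'m\<close> is
  \<open>int\<close>.\<close>

definition pm_eval :: "('b::comm_ring_1 \<Rightarrow> 'c::comm_ring_1) \<Rightarrow> ('m \<Rightarrow> 'c) \<Rightarrow> ('m \<Rightarrow>\<^sub>0 'b) \<Rightarrow> 'c" where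
  "pm_eval \<phi> \<chi> p = (\<Sum>m\<in>Poly_Mapping.keys p. \<phi> (Poly_Mapping.lookup p m) * \<chi> m)"

lemma (in ring_morphism) pm_eval_single: "pm_eval h \<chi> (Poly_Mapping.single m c) = h c * \<chi> m"
  by (simp add: pm_eval_def zero)

lemma (in ring_morphism) pm_eval_add: "pm_eval h \<chi> (p + q) = pm_eval h \<chi> p + pm_eval h \<chi> q"
  unfolding pm_eval_def
  by (rule setsum_keys_plus_distrib) (simp_all add: zero add distrib_right)

text \<open>Both sides of the product rule are additive in each factor, so it suffices to check
  single terms, where it follows from multiplicativity of \<open>h\<close> and the character law for
  \<open>\<chi>\<close>.\<close>

lemma (in ring_morphism) ring_morphism_pm_eval:
  fixes \<chi> :: "'m::comm_monoid_add \<Rightarrow> 'b"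
  assumes "\<chi> 0 = 1" and \<chi>: "\<And>m n. \<chi> (m + n) = \<chi> m * \<chi> n"
  shows "ring_morphism (pm_eval h \<chi>)"
proof
  let ?E = "pm_eval h \<chi>"
  have 1: "?E (Poly_Mapping.single m c * q) = ?E (Poly_Mapping.single m c) * ?E q" for m c q
    by (induction q rule: poly_mapping_single_induct)
      (simp_all add: mult_single pm_eval_single pm_eval_add mult \<chi> algebra_simps)
  show "?E (p * q) = ?E p * ?E q" for p q
    by (induction p rule: poly_mapping_single_induct)
      (simp_all add: 1 pm_eval_add distrib_right)
  show "?E 1 = 1"
    using pm_eval_single[of \<chi> 0 1] by (simp add: assms(1) one)
qed (rule pm_eval_add)

lemma mpoly_const_hom: "ring_hom_ring ring_of_type_algebra (mpoly_ring V) mpoly_const"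
proof (rule ring_hom_ringI)
  show "ring (mpoly_ring V)" by (rule cring.axioms(1)[OF cring_mpoly_ring])
qed (auto simp: carrier_mpoly_ring mpoly_const_def mult_single single_add)

text \<open>The preimage of the zero ideal of a domain is prime. This supplies both primes of the
  lower bound.\<close>

lemma primeideal_kernel:
  fixes h :: "_ \<Rightarrow> 'd::idom"
  assumes "ring_morphism h"
  shows "primeideal {p \<in> carrier (mpoly_ring V). h p = 0} (mpoly_ring V)"
proof -
  interpret h: ring_morphism h by fact
  have dom: "domain (ring_of_type_algebra :: 'd ring)"
    by (intro domain.intro domain_axioms.intro cring_from_type_algebra) auto
  have "ring_hom_ring (mpoly_ring V) (ring_of_type_algebra :: 'd ring) h"
    by (rule ring_hom_ringI)
      (auto simp: h.add h.mult h.one cring.axioms(1)[OF cring_mpoly_ring])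
  from ring_hom_ring.primeideal_vimage[OF this cring_mpoly_ring domain.zeroprimeideal[OF dom]]
  show ?thesis by simp
qed

section \<open>Descent of strict prime inclusions along adjoined square roots\<close>

lemma mpoly_mono: "V \<subseteq> W \<Longrightarrow> carrier (mpoly_ring V) \<subseteq> carrier (mpoly_ring W)"
  by (auto simp: carrier_mpoly_ring)

lemma mpoly_var_closed: "v \<in> V \<Longrightarrow> mpoly_var v \<in> carrier (mpoly_ring V)"
  by (simp add: carrier_mpoly_ring mpoly_var_def)

lemma mpoly_const_closed: "mpoly_const c \<in> carrier (mpoly_ring V)"
  by (simp add: carrier_mpoly_ring mpoly_const_def)

lemma mpoly_closed:
  assumes "p \<in> carrier (mpoly_ring V)" "q \<in> carrier (mpoly_ring V)"
  shows mpoly_add_closed: "p + q \<in> carrier (mpoly_ring V)"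
    and mpoly_mult_closed: "p * q \<in> carrier (mpoly_ring V)"
    and mpoly_diff_closed: "p - q \<in> carrier (mpoly_ring V)"
proof -
  interpret M: cring "mpoly_ring V" by (rule cring_mpoly_ring)
  show "p + q \<in> carrier (mpoly_ring V)" "p * q \<in> carrier (mpoly_ring V)"
    using assms M.add.m_closed[of p q] M.m_closed[of p q] by auto
  have "- q \<in> carrier (mpoly_ring V)" using assms by (simp add: carrier_mpoly_ring)
  then show "p - q \<in> carrier (mpoly_ring V)"
    using assms M.add.m_closed[of p "- q"] by auto
qed

lemma mpoly_ideal:
  assumes "ideal J (mpoly_ring W)"
  shows mpoly_ideal_zero: "0 \<in> J"
    and mpoly_ideal_add: "\<And>a b. a \<in> J \<Longrightarrow> b \<in> J \<Longrightarrow> a + b \<in> J"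
    and mpoly_ideal_mult: "\<And>a b. a \<in> J \<Longrightarrow> b \<in> carrier (mpoly_ring W) \<Longrightarrow> a * b \<in> J"
    and mpoly_ideal_diff: "\<And>a b. a \<in> J \<Longrightarrow> b \<in> J \<Longrightarrow> a - b \<in> J"
proof -
  interpret J: ideal J "mpoly_ring W" by fact
  show "0 \<in> J" using additive_subgroup.zero_closed[OF J.is_additive_subgroup] by simp
  show add: "a + b \<in> J" if "a \<in> J" "b \<in> J" for a b
    using additive_subgroup.a_closed[OF J.is_additive_subgroup that] by simp
  show mult: "a * b \<in> J" if "a \<in> J" "b \<in> carrier (mpoly_ring W)" for a b
    using J.I_r_closed[OF that] by simp
  have "- 1 \<in> carrier (mpoly_ring W)" by (simp add: carrier_mpoly_ring)
  then show "a - b \<in> J" if "a \<in> J" "b \<in> J" for a b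
    using add[OF that(1) mult[OF that(2), of "- 1"]] by simp
qed

text \<open>Division with remainder by a quadratic that is monic in the variable \<open>v\<close>,
  carried out first for powers of the variable, then for monomials, then for sums.\<close>

lemma mpoly_reduce_square:
  fixes u :: "'r::comm_ring_1"
  assumes J: "ideal J (mpoly_ring W)" and rel: "mpoly_var v ^ 2 - mpoly_const u \<in> J"
    and V: "insert v V \<subseteq> W"
    and x: "x \<in> carrier (mpoly_ring (insert v V))"
  shows "\<exists>p\<in>carrier (mpoly_ring V). \<exists>q\<in>carrier (mpoly_ring V). x - (p + q * mpoly_var v) \<in> J"
proof -
  note J_add = mpoly_ideal_add[OF J] and J_mult = mpoly_ideal_mult[OF J]
    and J_zero = mpoly_ideal_zero[OF J]
  have vW: "mpoly_var v \<in> carrier (mpoly_ring W)" using V by (intro mpoly_var_closed) auto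
  have VW: "carrier (mpoly_ring V) \<subseteq> carrier (mpoly_ring W)" using V by (intro mpoly_mono) auto
  \<comment> \<open>Multiplying \<open>c + d b\<close> by \<open>b\<close> gives
    \<open>c b + d b^2\<close>, where \<open>b^2\<close> may be replaced by \<open>u\<close> modulo
    \<open>J\<close>.\<close>
  have pow: "\<exists>c d. mpoly_var v ^ e - (mpoly_const c + mpoly_const d * mpoly_var v) \<in> J" for e
  proof (induction e)
    case 0
    show ?case
      by (rule exI[of _ 1], rule exI[of _ 0]) (simp add: mpoly_const_def J_zero)
  next
    case (Suc e)
    then obtain c d
      where cd: "mpoly_var v ^ e - (mpoly_const c + mpoly_const d * mpoly_var v) \<in> J" (is "?a \<in> J")
      by blast
    have "?a * mpoly_var v + (mpoly_var v ^ 2 - mpoly_const u) * mpoly_const d \<in> J"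
      by (intro J_add J_mult cd rel vW mpoly_const_closed)
    also have "?a * mpoly_var v + (mpoly_var v ^ 2 - mpoly_const u) * mpoly_const d =
        mpoly_var v ^ Suc e - (mpoly_const u * mpoly_const d + mpoly_const c * mpoly_var v)"
      by (simp add: algebra_simps power2_eq_square)
    also have "mpoly_const u * mpoly_const d = mpoly_const (u * d)"
      by (simp add: mpoly_const_def mult_single)
    finally show ?case by blast
  qed
  let ?T = "\<lambda>x. \<exists>p\<in>carrier (mpoly_ring V). \<exists>q\<in>carrier (mpoly_ring V).
    x - (p + q * mpoly_var v) \<in> J"
  have mono: "?T (Poly_Mapping.single m c)"
    if "Poly_Mapping.keys m \<subseteq> insert v V" for m and c :: 'r
  proof -
    define m0 where "m0 = Poly_Mapping.update v 0 m"
    define e where "e = Poly_Mapping.lookup m v"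
    have var_pow: "(mpoly_var v ^ k :: ('a, 'r) mpoly) =
        Poly_Mapping.single (Poly_Mapping.single v k) 1" for k
      by (induction k) (simp_all add: mpoly_var_def mult_single single_add[symmetric])
    have "m = m0 + Poly_Mapping.single v e"
      by (rule poly_mapping_eqI)
        (auto simp: m0_def e_def lookup_add lookup_update lookup_single when_def)
    then have m: "Poly_Mapping.single m c = Poly_Mapping.single m0 c * mpoly_var v ^ e"
      by (simp add: var_pow mult_single)
    have m0: "Poly_Mapping.single m0 c \<in> carrier (mpoly_ring V)"
      using that by (auto simp: carrier_mpoly_ring m0_def keys_update)
    from pow obtain c' d
      where "mpoly_var v ^ e - (mpoly_const c' + mpoly_const d * mpoly_var v) \<in> J" (is "?a \<in> J")
      by blast
    then have "?a * Poly_Mapping.single m0 c \<in> J"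
      using m0 VW by (intro J_mult) auto
    then have "Poly_Mapping.single m c - (Poly_Mapping.single m0 c * mpoly_const c' +
        (Poly_Mapping.single m0 c * mpoly_const d) * mpoly_var v) \<in> J"
      by (simp add: m algebra_simps)
    then show ?thesis
      using mpoly_mult_closed[OF m0 mpoly_const_closed] by blast
  qed
  have add: "?T (x + y)" if "?T x" "?T y" for x y
  proof -
    from that obtain p q p' q'
      where p: "p \<in> carrier (mpoly_ring V)" "q \<in> carrier (mpoly_ring V)"
        "p' \<in> carrier (mpoly_ring V)" "q' \<in> carrier (mpoly_ring V)"
        and J: "x - (p + q * mpoly_var v) \<in> J" "y - (p' + q' * mpoly_var v) \<in> J"
      by blast
    have "x + y - ((p + p') + (q + q') * mpoly_var v) \<in> J"
      using J_add[OF J] by (simp add: algebra_simps)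
    then show ?thesis using p mpoly_add_closed by blast
  qed
  \<comment> \<open>The carrier condition is kept inside the induction formula: the monomial added
    in each step is new, so it cancels nothing and \<open>x\<close> inherits the condition from the
    sum.\<close>
  have "x \<in> carrier (mpoly_ring (insert v V)) \<longrightarrow> ?T x"
  proof (induction x rule: update_induct)
    case const
    show ?case using mono[of 0 0] by simp
  next
    case (update x m c)
    have *: "Poly_Mapping.update m c x = Poly_Mapping.single m c + x"
      using update(1)
      by (intro poly_mapping_eqI)
        (auto simp: lookup_update lookup_add lookup_single when_def in_keys_iff)
    show ?case
    proof
      assume "Poly_Mapping.update m c x \<in> carrier (mpoly_ring (insert v V))"
      then have "Poly_Mapping.keys m \<subseteq> insert v V" "x \<in> carrier (mpoly_ring (insert v V))"
        using update by (auto simp: carrier_mpoly_ring keys_update lookup_update in_keys_iff)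
      then show "?T (Poly_Mapping.update m c x)"
        using * update add[OF mono] by metis
    qed
  qed
  with x show ?thesis by blast
qed

text \<open>Incomparability for an integral extension, made explicit. An element separating
  \<open>Q\<close> from \<open>Q'\<close> is traded for one with a variable fewer, until it is a
  constant. Its norm serves unless it falls into \<open>Q\<close>; in that case the conjugate lies
  in \<open>Q\<close>, and the square of the element is used instead.\<close>

lemma square_extension_incomparable:
  fixes u :: "'v \<Rightarrow> 'r::comm_ring_1"
  assumes prime: "primeideal Q (mpoly_ring W)" "primeideal Q' (mpoly_ring W)"
    and sub: "Q \<subseteq> Q'"
    and rel: "\<And>v. v \<in> W \<Longrightarrow> mpoly_var v ^ 2 - mpoly_const (u v) \<in> Q"
    and fin: "finite V" and V: "V \<subseteq> W"
    and x: "x \<in> carrier (mpoly_ring V)" "x \<in> Q'" "x \<notin> Q"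
  shows "\<exists>c. mpoly_const c \<in> Q' \<and> mpoly_const c \<notin> Q"
  using fin V x
proof (induction V arbitrary: x)
  case empty
  then have "Poly_Mapping.keys x \<subseteq> {0}" by (auto simp: carrier_mpoly_ring)
  then have "x = mpoly_const (Poly_Mapping.lookup x 0)"
    by (intro poly_mapping_eqI) (auto simp: mpoly_const_def lookup_single when_def in_keys_iff)
  then show ?case using empty by metis
next
  case (insert v V)
  interpret Q: primeideal Q "mpoly_ring W" by (rule prime)
  interpret Q': primeideal Q' "mpoly_ring W" by (rule prime)
  note Q_add = mpoly_ideal_add[OF Q.is_ideal] and Q_mult = mpoly_ideal_mult[OF Q.is_ideal]
    and Q_diff = mpoly_ideal_diff[OF Q.is_ideal]
    and Q'_add = mpoly_ideal_add[OF Q'.is_ideal] and Q'_mult = mpoly_ideal_mult[OF Q'.is_ideal]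
    and Q'_diff = mpoly_ideal_diff[OF Q'.is_ideal]
  have Q_prime: "a \<in> Q \<or> b \<in> Q"
    if "a \<in> carrier (mpoly_ring W)" "b \<in> carrier (mpoly_ring W)" "a * b \<in> Q" for a b
    using Q.I_prime[of a b] that by simp
  let ?b = "mpoly_var v :: ('v, 'r) mpoly" and ?u = "mpoly_const (u v) :: ('v, 'r) mpoly"
  have VW: "V \<subseteq> W" and v: "v \<in> W" using insert by auto
  obtain p q where p: "p \<in> carrier (mpoly_ring V)" and q: "q \<in> carrier (mpoly_ring V)"
    and x: "x - (p + q * ?b) \<in> Q"
    using mpoly_reduce_square[OF Q.is_ideal rel[OF v] insert.prems(1,2)] by blast
  have b: "?b \<in> carrier (mpoly_ring W)" using v by (rule mpoly_var_closed)
  have pW: "p \<in> carrier (mpoly_ring W)" and qW: "q \<in> carrier (mpoly_ring W)"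
    using p q mpoly_mono[OF VW] by auto
  \<comment> \<open>The linear remainder \<open>y\<close> differs from \<open>x\<close> by an
    element of \<open>Q\<close>, hence also of \<open>Q'\<close>, so it separates the two primes as
    well.\<close>
  define y where "y = p + q * ?b"
  have qb: "q * ?b \<in> carrier (mpoly_ring W)" by (rule mpoly_mult_closed[OF qW b])
  have yW: "y \<in> carrier (mpoly_ring W)" unfolding y_def by (rule mpoly_add_closed[OF pW qb])
  have y_bar: "p - q * ?b \<in> carrier (mpoly_ring W)" by (rule mpoly_diff_closed[OF pW qb])
  have "y \<in> Q'"
    using Q'_diff[OF insert.prems(3), of "x - y"] x sub by (auto simp: y_def)
  have "y \<notin> Q"
  proof
    assume "y \<in> Q"
    then have "x - y + y \<in> Q" using x by (intro Q_add) (simp_all add: y_def)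
    then show False using insert.prems by simp
  qed
  have rel_q: "(?b ^ 2 - ?u) * (q * q) \<in> Q"
    by (intro Q_mult rel v mpoly_mult_closed qW)
  \<comment> \<open>The norm of \<open>y\<close>, with \<open>?b ^ 2\<close> replaced by
    \<open>?u\<close>. Modulo \<open>Q\<close> it is \<open>y\<close> times the conjugate of
    \<open>y\<close>, which places it in \<open>Q'\<close>.\<close>
  define N where "N = p * p - q * q * ?u"
  have closed: "N \<in> carrier (mpoly_ring V)"
    unfolding N_def by (intro mpoly_diff_closed mpoly_mult_closed p q mpoly_const_closed)
  have N: "N = y * (p - q * ?b) + (?b ^ 2 - ?u) * (q * q)"
    by (simp add: N_def y_def algebra_simps power2_eq_square)
  have "N \<in> Q'"
    unfolding N using Q'_add[OF Q'_mult[OF \<open>y \<in> Q'\<close> y_bar], of "(?b ^ 2 - ?u) * (q * q)"]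
      rel_q sub by auto
  show ?case
  proof (cases "N \<in> Q")
    case False
    then show ?thesis using insert.IH[OF VW closed \<open>N \<in> Q'\<close>] by blast
  next
    case True
    then have "y * (p - q * ?b) \<in> Q"
      using Q_diff[OF True rel_q] by (simp add: N)
    then have bar: "p - q * ?b \<in> Q" using Q_prime[OF yW y_bar] \<open>y \<notin> Q\<close> by blast
    \<comment> \<open>modulo \<open>Q\<close>, \<open>p = q b\<close> and hence \<open>y\<^sup>2 = 4 q\<^sup>2 b\<^sup>2\<close>, which no longer involves \<open>b\<close>\<close>
    define w where "w = q * q * ?u * mpoly_const 4"
    have four: "mpoly_const 4 = (4 :: ('v, 'r) mpoly)"
      by (simp add: mpoly_const_def)
    have w: "w \<in> carrier (mpoly_ring V)"
      unfolding w_def by (intro mpoly_mult_closed q mpoly_const_closed)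
    have "y * y - w = (p - q * ?b) * (y + q * ?b + q * ?b) +
        (?b ^ 2 - ?u) * (q * q) * mpoly_const 4"
      unfolding w_def four y_def by (simp add: algebra_simps power2_eq_square)
    also have "\<dots> \<in> Q"
      by (intro Q_add Q_mult bar rel_q mpoly_add_closed yW qb mpoly_const_closed)
    finally have yw: "y * y - w \<in> Q" .
    have "w \<notin> Q"
    proof
      assume "w \<in> Q"
      then have "y * y \<in> Q" using Q_add[OF yw, of w] by simp
      then show False using Q_prime[OF yW yW] \<open>y \<notin> Q\<close> by blast
    qed
    moreover have "w \<in> Q'"
      using Q'_diff[OF Q'_mult[OF \<open>y \<in> Q'\<close> yW], of "y * y - w"] yw sub by auto
    ultimately show ?thesis using insert.IH[OF VW w] by blast
  qed
qed

section \<open>Primes in a localization of k[z]\<close>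

text \<open>A non-constant \<open>p\<close> splits off a linear factor, and primality selects that
  factor or the cofactor of smaller degree. A non-zero constant maps to a unit and cannot lie in
  \<open>q\<close>.\<close>

lemma prime_contains_linear:
  fixes \<psi> :: "'k::alg_closed_field poly \<Rightarrow> 'r::comm_ring_1"
  assumes "ring_morphism \<psi>" and q: "primeideal q (ring_of_type_algebra :: 'r ring)"
    and "p \<noteq> 0" "\<psi> p \<in> q"
  shows "\<exists>c. \<psi> [:- c, 1:] \<in> q"
  using assms(3,4)
proof (induction "degree p" arbitrary: p rule: less_induct)
  case less
  interpret \<psi>: ring_morphism \<psi> by fact
  interpret q: primeideal q "ring_of_type_algebra :: 'r ring" by (rule q)
  show ?case
  proof (cases "degree p = 0")
    case True
    then obtain a where p: "p = [:a:]" using degree_eq_zeroE by blast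
    then have "\<psi> p * \<psi> [:inverse a:] = \<psi> 1"
      using less.prems by (simp flip: \<psi>.mult add: one_pCons)
    then have "1 \<in> q"
      using q.I_r_closed[OF less.prems(2), of "\<psi> [:inverse a:]"] by (simp add: \<psi>.one)
    then show ?thesis
      using q.one_imp_carrier q.I_notcarr by simp
  next
    case False
    then obtain c where "poly p c = 0"
      using alg_closed_imp_poly_has_root by blast
    then obtain p' where p': "p = [:- c, 1:] * p'" by (auto simp: poly_eq_0_iff_dvd)
    with less.prems have "p' \<noteq> 0" by auto
    have "\<psi> [:- c, 1:] * \<psi> p' \<in> q" using less.prems p' by (metis \<psi>.mult)
    then have "\<psi> [:- c, 1:] \<in> q \<or> \<psi> p' \<in> q"
      using q.I_prime[of "\<psi> [:- c, 1:]" "\<psi> p'"] by simp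
    moreover have "degree p' < degree p"
      unfolding p' using \<open>p' \<noteq> 0\<close> by (subst degree_mult_eq) auto
    ultimately show ?thesis using less.hyps \<open>p' \<noteq> 0\<close> by blast
  qed
qed

text \<open>Up to units \<open>a\<close> and \<open>b\<close> are images of polynomials. The one for
  \<open>a\<close> is non-zero, so \<open>q1\<close> contains some \<open>\<psi> [:- c, 1:]\<close>.
  Modulo \<open>q1\<close> the image of a polynomial is then that of its value at \<open>c\<close>;
  for \<open>b\<close> this value is non-zero and its image lies in \<open>q2\<close>, which
  therefore contains a unit.\<close>

lemma polynomial_localization_no_prime_chain:
  fixes \<psi> :: "'k::alg_closed_field poly \<Rightarrow> 'r::comm_ring_1"
  assumes "ring_morphism \<psi>"
    and loc: "\<And>a. \<exists>w p. w dvd 1 \<and> w * a = \<psi> p"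
    and q: "primeideal q0 (ring_of_type_algebra :: 'r ring)"
      "primeideal q1 (ring_of_type_algebra :: 'r ring)"
      "primeideal q2 (ring_of_type_algebra :: 'r ring)"
    and "a \<in> q1" "a \<notin> q0" "b \<in> q2" "b \<notin> q1" "q1 \<subseteq> q2"
  shows False
proof -
  interpret \<psi>: ring_morphism \<psi> by fact
  interpret q0: primeideal q0 "ring_of_type_algebra :: 'r ring" by (rule q)
  interpret q1: primeideal q1 "ring_of_type_algebra :: 'r ring" by (rule q)
  interpret q2: primeideal q2 "ring_of_type_algebra :: 'r ring" by (rule q)
  have mult1: "x * y \<in> q1" "y * x \<in> q1" if "x \<in> q1" for x y
    using q1.I_r_closed[OF that, of y] by (simp_all add: mult.commute)
  have mult2: "x * y \<in> q2" "y * x \<in> q2" if "x \<in> q2" for x y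
    using q2.I_r_closed[OF that, of y] by (simp_all add: mult.commute)
  have add2: "x + y \<in> q2" if "x \<in> q2" "y \<in> q2" for x y
    using additive_subgroup.a_closed[OF q2.is_additive_subgroup that] by simp
  have zero: "0 \<in> q0"
    using additive_subgroup.zero_closed[OF q0.is_additive_subgroup] by simp
  obtain w p where w: "w dvd 1" "w * a = \<psi> p" using loc by blast
  \<comment> \<open>Otherwise \<open>a\<close>, being a unit multiple of \<open>\<psi> p\<close>,
    would be zero and lie in \<open>q0\<close>.\<close>
  have "p \<noteq> 0"
  proof
    assume "p = 0"
    then have "w * a = 0" using w \<psi>.zero by simp
    moreover obtain w' where "1 = w * w'" using w(1) by (rule dvdE)
    ultimately have "a = 0" by (metis mult.assoc mult.commute mult.left_neutral mult_zero_right)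
    then show False using zero assms by simp
  qed
  moreover have "\<psi> p \<in> q1" using mult1(2)[OF \<open>a \<in> q1\<close>, of w] w by simp
  ultimately obtain c where c: "\<psi> [:- c, 1:] \<in> q1"
    using prime_contains_linear[OF assms(1) q(2)] by blast
  obtain v p' where v: "v dvd 1" "v * b = \<psi> p'" using loc by blast
  \<comment> \<open>Subtracting the value at \<open>c\<close> leaves a multiple of the linear
    polynomial known to map into \<open>q1\<close>.\<close>
  obtain g where g: "p' - [:poly p' c:] = [:- c, 1:] * g"
    using poly_eq_0_iff_dvd[of "p' - [:poly p' c:]" c] by auto
  have p': "\<psi> p' - \<psi> [:poly p' c:] \<in> q1"
    using mult1(1)[OF c, of "\<psi> g"] by (simp add: \<psi>.mult[symmetric] \<psi>.diff[symmetric] g)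
  have "\<psi> p' \<notin> q1"
  proof
    obtain v' where v': "1 = v * v'" using v(1) by (rule dvdE)
    assume "\<psi> p' \<in> q1"
    then have "\<psi> p' * v' \<in> q1" by (rule mult1)
    also have "\<psi> p' * v' = b"
      using v v' by (metis mult.assoc mult.commute mult.left_neutral)
    finally show False using assms by simp
  qed
  then have nz: "poly p' c \<noteq> 0" using p' \<psi>.zero by auto
  have "\<psi> p' \<in> q2" using mult2(2)[OF \<open>b \<in> q2\<close>, of v] v by simp
  moreover have "(\<psi> p' - \<psi> [:poly p' c:]) * (- 1) \<in> q2"
    using mult2 p' \<open>q1 \<subseteq> q2\<close> by blast
  ultimately have "\<psi> [:poly p' c:] \<in> q2" using add2 by fastforce
  then have "\<psi> [:poly p' c:] * \<psi> [:inverse (poly p' c):] \<in> q2" by (rule mult2)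
  then have "1 \<in> q2" using nz by (simp flip: \<psi>.mult \<psi>.one add: one_pCons)
  then show False using q2.one_imp_carrier q2.I_notcarr by simp
qed

section \<open>Square roots in k[[t]] and iterates of \<sigma>\<close>

text \<open>The character on monomials with which \<open>pm_eval\<close> substitutes
  \<open>s v\<close> for each variable \<open>v\<close>.\<close>

definition monom_eval :: "('v \<Rightarrow> 'b::comm_ring_1) \<Rightarrow> ('v \<Rightarrow>\<^sub>0 nat) \<Rightarrow> 'b" where
  "monom_eval s m = (\<Prod>v\<in>Poly_Mapping.keys m. s v ^ Poly_Mapping.lookup m v)"

lemma monom_eval_superset:
  assumes "finite S" "Poly_Mapping.keys m \<subseteq> S"
  shows "monom_eval s m = (\<Prod>v\<in>S. s v ^ Poly_Mapping.lookup m v)"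
  unfolding monom_eval_def using assms
  by (intro prod.mono_neutral_left) (auto simp: in_keys_iff)

lemma monom_eval_add: "monom_eval s (m + n) = monom_eval s m * monom_eval s n"
proof -
  let ?S = "Poly_Mapping.keys m \<union> Poly_Mapping.keys n"
  have "Poly_Mapping.keys (m + n) \<subseteq> ?S" by (rule Poly_Mapping.keys_add)
  then show ?thesis
    by (simp add: monom_eval_superset[of ?S] lookup_add power_add prod.distrib)
qed

text \<open>The constant term is \<open>a + b\<close>. If it is non-zero, its square root extends to
  a power series; if it vanishes, the series collapses to \<open>a t^2\<close>, the square of
  \<open>t' * fps_X\<close>.\<close>

lemma fps_affine_square:
  fixes a b :: "'k::{alg_closed_field, field_char_0}"
  shows "\<exists>s. s ^ 2 = fps_const a * (1 + fps_X ^ 2) + fps_const b"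
proof -
  obtain t where t: "t ^ 2 = a + b" using nth_root_exists[of 2] by auto
  obtain t' where t': "t' ^ 2 = a" using nth_root_exists[of 2] by auto
  define g where "g = fps_const a * (1 + fps_X ^ 2) + fps_const b"
  have g0: "g $ 0 = a + b" by (simp add: g_def)
  show ?thesis
  proof (cases "a + b = 0")
    case True
    then have "b = - a" by (simp add: eq_neg_iff_add_eq_0 add.commute)
    then have "(fps_const t' * fps_X) ^ 2 = g"
      by (simp add: g_def t'[symmetric] power_mult_distrib algebra_simps flip: fps_const_neg)
    then show ?thesis unfolding g_def by blast
  next
    case False
    \<comment> \<open>The first argument of \<open>fps_radical\<close> chooses the root of the
      constant coefficient, here always \<open>t\<close>. The exponent two appears as
      \<open>Suc 1\<close> to fit \<open>power_radical\<close>.\<close>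
    have "fps_radical (\<lambda>_ _. t) (Suc 1) g ^ Suc 1 = g"
      using power_radical[of g "\<lambda>_ _. t" 1] False g0 t by (simp add: numeral_2_eq_2)
    then show ?thesis unfolding g_def by (metis Suc_1)
  qed
qed

text \<open>Powers with exponent \<open>n\<close> of affine expressions in \<open>z\<close> form a
  set stable under \<open>\<sigma>\<close> and, as \<open>\<xi>\<close> is invertible, under its
  inverse. The shift is the case \<open>\<xi> = 1\<close>, \<open>\<delta> = 1\<close>, the scaling
  the case \<open>\<delta> = 0\<close>.\<close>

lemma int_iterate_affine:
  fixes \<iota> :: "'k::field \<Rightarrow> 'r::comm_ring_1"
  assumes "algebra_automorphism \<iota> \<sigma>" and "ring_morphism \<iota>"
    and \<sigma>z: "\<sigma> z = \<iota> \<xi> * z + \<iota> \<delta>" and "\<xi> \<noteq> 0"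
  shows "\<exists>a b. int_iterate \<sigma> m ((z - \<iota> c) ^ n) = (\<iota> a * z + \<iota> b) ^ n"
proof -
  interpret \<iota>: ring_morphism \<iota> by fact
  have \<sigma>: "bij \<sigma>" "\<And>x y. \<sigma> (x + y) = \<sigma> x + \<sigma> y" "\<And>x y. \<sigma> (x * y) = \<sigma> x * \<sigma> y"
    "\<And>c. \<sigma> (\<iota> c) = \<iota> c"
    using assms(1) by (auto simp: algebra_automorphism_def)
  have "\<sigma> 1 = 1" using \<sigma>(4)[of 1] by (simp add: \<iota>.one)
  then have pow: "\<sigma> (x ^ n) = \<sigma> x ^ n" for x by (induction n) (simp_all add: \<sigma>)
  let ?T = "{(\<iota> a * z + \<iota> b) ^ n | a b. True}"
  have step: "\<sigma> ((\<iota> a * z + \<iota> b) ^ n) = (\<iota> (a * \<xi>) * z + \<iota> (a * \<delta> + b)) ^ n" for a b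
    by (simp add: pow \<sigma> \<sigma>z \<iota>.add \<iota>.mult algebra_simps)
  have fwd: "\<sigma> x \<in> ?T" if "x \<in> ?T" for x using that step by auto
  have bwd: "inv_into UNIV \<sigma> x \<in> ?T" if "x \<in> ?T" for x
  proof -
    from that obtain a b where x: "x = (\<iota> a * z + \<iota> b) ^ n" by blast
    \<comment> \<open>The coefficients come from solving the formula in \<open>step\<close> for its
      arguments.\<close>
    have "\<sigma> ((\<iota> (a / \<xi>) * z + \<iota> (b - a / \<xi> * \<delta>)) ^ n) = x"
      using \<open>\<xi> \<noteq> 0\<close> by (simp add: step x)
    then have "inv_into UNIV \<sigma> x = (\<iota> (a / \<xi>) * z + \<iota> (b - a / \<xi> * \<delta>)) ^ n"
      using \<sigma>(1) by (metis bij_is_inj inv_f_f)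
    then show ?thesis by blast
  qed
  have iter: "(\<tau> ^^ k) x \<in> ?T" if "x \<in> ?T" "\<And>x. x \<in> ?T \<Longrightarrow> \<tau> x \<in> ?T" for \<tau> k x
    using that(1) by (induction k) (simp_all only: funpow.simps id_apply o_apply that(2))
  have "(z - \<iota> c) ^ n = (\<iota> 1 * z + \<iota> (- c)) ^ n" by (simp add: \<iota>.one \<iota>.minus)
  then have "(z - \<iota> c) ^ n \<in> ?T" by blast
  then have "int_iterate \<sigma> m ((z - \<iota> c) ^ n) \<in> ?T"
    unfolding int_iterate_def using iter[OF _ fwd] iter[OF _ bwd]
    by (simp only: split: if_split) blast
  then show ?thesis by blast
qed

section \<open>The dimension of B over a general base ring\<close>

lemma B_relations_closed: "B_relations \<iota> z \<sigma> r \<alpha> n \<subseteq> carrier (mpoly_ring ({1..r} \<times> UNIV))"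
  by (auto simp: B_relations_def power2_eq_square
    intro!: mpoly_diff_closed mpoly_mult_closed mpoly_var_closed mpoly_const_closed)

text \<open>The argument common to both base rings. Through \<open>\<psi>\<close> every element of
  \<open>R\<close> is a polynomial up to a unit, as the upper bound needs; \<open>\<phi>\<close> is
  the substitution of \<open>1 + t^2\<close> for \<open>z\<close>, as the lower bound needs.\<close>

lemma krull_dim_B_ring:
  fixes \<psi> :: "'k::{alg_closed_field, field_char_0} poly \<Rightarrow> 'r::comm_ring_1"
    and \<phi> :: "'r \<Rightarrow> 'k fps"
  defines "\<iota> \<equiv> \<lambda>c. \<psi> [:c:]" and "z \<equiv> \<psi> [:0, 1:]"
  assumes \<psi>: "ring_morphism \<psi>" and loc: "\<And>a. \<exists>w p. w dvd 1 \<and> w * a = \<psi> p"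
    and "ring_morphism \<phi>" and \<phi>_const: "\<And>c. \<phi> (\<iota> c) = fps_const c"
    and \<phi>_z: "\<phi> z = 1 + fps_X ^ 2"
    and \<sigma>: "algebra_automorphism \<iota> \<sigma>" "\<sigma> z = \<iota> \<xi> * z + \<iota> \<delta>" "\<xi> \<noteq> 0"
  shows "krull_dim (B_ring \<iota> z \<sigma> r \<alpha> n) = 1"
proof -
  interpret \<psi>: ring_morphism \<psi> by fact
  interpret \<phi>: ring_morphism \<phi> by fact
  have \<iota>: "ring_morphism \<iota>"
    by unfold_locales (simp_all add: \<iota>_def one_pCons[symmetric] \<psi>.one mult.commute flip: \<psi>.add \<psi>.mult)
  define u where "u = (\<lambda>(i, j). int_iterate \<sigma> (- j) ((z - \<iota> (\<alpha> i)) ^ n i))"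
  \<comment> \<open>The right-hand side of each relation is a power of an affine expression; the
    latter becomes a square in k[[t]], and powers of squares are squares.\<close>
  have "\<exists>s. s ^ 2 = \<phi> (u v)" for v
  proof -
    obtain i j where v: "v = (i, j)" by (cases v)
    have "\<exists>a b. u v = (\<iota> a * z + \<iota> b) ^ n i"
      unfolding v u_def split_conv by (rule int_iterate_affine[OF \<sigma>(1) \<iota> \<sigma>(2,3)])
    then obtain a b where "u v = (\<iota> a * z + \<iota> b) ^ n i" by blast
    then have "\<phi> (u v) = (fps_const a * (1 + fps_X ^ 2) + fps_const b) ^ n i"
      by (simp add: \<phi>.power \<phi>.add \<phi>.mult \<phi>_const \<phi>_z)
    then show ?thesis
      using fps_affine_square[of a b] by (metis power_mult mult.commute)
  qed
  then obtain s where s: "\<And>v. s v ^ 2 = \<phi> (u v)" by metis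
  \<comment> \<open>Sends each variable to its chosen square root, so it kills the relations and
    induces the map from B to k[[t]].\<close>
  define \<Phi> where "\<Phi> = pm_eval \<phi> (monom_eval s)"
  have \<Phi>: "ring_morphism \<Phi>"
    unfolding \<Phi>_def
    by (rule \<phi>.ring_morphism_pm_eval) (simp add: monom_eval_def, rule monom_eval_add)
  interpret \<Phi>: ring_morphism \<Phi> by (rule \<Phi>)
  have \<Phi>_const: "\<Phi> (mpoly_const c) = \<phi> c" for c
    by (simp add: \<Phi>_def mpoly_const_def \<phi>.pm_eval_single monom_eval_def)
  have \<Phi>_var: "\<Phi> (mpoly_var v) = s v" for v
    by (simp add: \<Phi>_def mpoly_var_def \<phi>.pm_eval_single \<phi>.one monom_eval_def)
  let ?W = "{1..r} \<times> (UNIV :: int set)"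
  let ?M = "mpoly_ring ?W :: (nat \<times> int, 'r) mpoly ring"
  let ?rel = "B_relations \<iota> z \<sigma> r \<alpha> n"
  let ?I = "genideal ?M ?rel"
  interpret M: cring ?M by (rule cring_mpoly_ring)
  have I: "ideal ?I ?M" by (rule M.genideal_ideal[OF B_relations_closed])
  \<comment> \<open>The preimages of \<open>0\<close> and \<open>(t)\<close>. The second is again a
    kernel, that of \<open>\<Phi>\<close> followed by the constant coefficient.\<close>
  let ?P = "{p \<in> carrier ?M. \<Phi> p = 0}" and ?P' = "{p \<in> carrier ?M. \<Phi> p $ 0 = 0}"
  show ?thesis
    unfolding B_ring_def
  proof (rule M.krull_dim_quot_eq_oneI[OF I])
    show P: "primeideal ?P ?M" by (rule primeideal_kernel[OF \<Phi>])
    show "primeideal ?P' ?M"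
      by (rule primeideal_kernel) (unfold_locales, simp_all add: \<Phi>.add \<Phi>.mult \<Phi>.one)
    have "?rel \<subseteq> ?P"
      using B_relations_closed[of \<iota> z \<sigma> r \<alpha> n]
      by (auto simp: B_relations_def \<Phi>.diff \<Phi>.power \<Phi>_const \<Phi>_var s u_def)
    then show "?I \<subseteq> ?P"
      using P by (intro M.genideal_minimal) (simp_all add: primeideal_def)
    let ?x = "mpoly_const (z - \<iota> 1)"
    have "\<Phi> ?x = fps_X ^ 2"
      by (simp add: \<Phi>_const \<phi>.diff \<phi>_z \<phi>_const)
    then have "?x \<in> ?P'" "?x \<notin> ?P"
      using mpoly_const_closed[of "z - \<iota> 1" ?W] by simp_all
    moreover have "?P \<subseteq> ?P'" by auto
    ultimately show "?P \<subset> ?P'" by blast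
  next
    fix P0 P1 P2
    assume P: "primeideal P0 ?M" "primeideal P1 ?M" "primeideal P2 ?M"
      and sub: "?I \<subseteq> P0" "P0 \<subset> P1" "P1 \<subset> P2"
    have rel: "mpoly_var v ^ 2 - mpoly_const (u v) \<in> P0" if "v \<in> ?W" for v
    proof -
      have "mpoly_var v ^ 2 - mpoly_const (u v) \<in> ?rel"
        using that by (auto simp: B_relations_def u_def)
      then show ?thesis
        using M.genideal_self[OF B_relations_closed[of \<iota> z \<sigma> r \<alpha> n]] sub(1) by blast
    qed
    have descend: "\<exists>c. mpoly_const c \<in> Q' \<and> mpoly_const c \<notin> Q"
      if Q: "primeideal Q ?M" "primeideal Q' ?M" "Q \<subset> Q'" "P0 \<subseteq> Q" for Q Q'
    proof -
      obtain x where x: "x \<in> Q'" "x \<notin> Q" using Q by blast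
      have "x \<in> carrier ?M"
        using x Q(2) by (meson additive_subgroup.a_Hcarr ideal.axioms(1) primeideal_def)
      \<comment> \<open>Only finitely many variables occur in \<open>x\<close>, so the induction
        over finite variable sets applies.\<close>
      let ?V = "\<Union>m\<in>Poly_Mapping.keys x. Poly_Mapping.keys m"
      have "?V \<subseteq> ?W" "x \<in> carrier (mpoly_ring ?V)"
        using \<open>x \<in> carrier ?M\<close> by (auto simp: carrier_mpoly_ring)
      moreover have "mpoly_var v ^ 2 - mpoly_const (u v) \<in> Q" if "v \<in> ?W" for v
        using rel[OF that] Q(4) by blast
      moreover have "finite ?V" by simp
      moreover have "Q \<subseteq> Q'" using Q(3) by blast
      ultimately show ?thesis
        using square_extension_incomparable[OF Q(1,2) _ _ _ _ _ x, of u ?V] by blast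
    qed
    \<comment> \<open>The contractions to \<open>R\<close>; the constants supplied by
      \<open>descend\<close> keep successive ones distinct.\<close>
    let ?q = "\<lambda>P. {c \<in> carrier (ring_of_type_algebra :: 'r ring). mpoly_const c \<in> P}"
    have q: "primeideal (?q Q) (ring_of_type_algebra :: 'r ring)" if "primeideal Q ?M" for Q
      by (rule ring_hom_ring.primeideal_vimage[OF mpoly_const_hom cring_from_type_algebra that])
    obtain a where "mpoly_const a \<in> P1" "mpoly_const a \<notin> P0"
      using descend[OF P(1,2)] sub by blast
    moreover obtain b where "mpoly_const b \<in> P2" "mpoly_const b \<notin> P1"
      using descend[OF P(2,3)] sub by blast
    ultimately show False
      using polynomial_localization_no_prime_chain[OF \<psi> loc q[OF P(1)] q[OF P(2)] q[OF P(3)], of a b]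
        sub by auto
  qed
qed

section \<open>The two base rings\<close>

text \<open>Substitution of \<open>x\<close> for the variable; used for the map from k[z] to k[[t]]
  and for the inclusion of k[z] into the Laurent polynomials.\<close>

lemma (in ring_morphism) ring_morphism_poly_map_poly:
  "ring_morphism (\<lambda>p. poly (map_poly h p) x)"
proof
  let ?E = "\<lambda>p. poly (map_poly h p) x"
  have pCons: "?E (pCons a p) = h a + x * ?E p" for a p
    by (simp add: map_poly_pCons zero)
  have smult: "?E (smult a p) = h a * ?E p" for a p
    by (induction p) (simp_all add: pCons mult algebra_simps)
  show add: "?E (p + q) = ?E p + ?E q" for p q
    by (induction p q rule: poly_induct2) (simp_all add: pCons add algebra_simps)
  show "?E (p * q) = ?E p * ?E q" for p q
    by (induction p) (simp_all add: pCons smult add zero algebra_simps)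
  show "?E 1 = 1"
    by (simp add: one_pCons pCons one)
qed

lemma ring_morphism_fps_const: "ring_morphism fps_const"
  by unfold_locales (simp_all flip: fps_const_add fps_const_mult)

lemma ring_morphism_laurent_const: "ring_morphism laurent_const"
  by unfold_locales (simp_all add: single_add mult_single)

lemma krull_dim_B_ring_poly:
  fixes \<sigma> :: "'k::{alg_closed_field, field_char_0} poly \<Rightarrow> 'k poly"
  assumes "algebra_automorphism poly_const \<sigma>" "\<sigma> poly_z = poly_z + 1"
  shows "krull_dim (B_ring poly_const poly_z \<sigma> r \<alpha> n) = 1"
proof -
  let ?\<phi> = "\<lambda>p :: 'k poly. poly (map_poly fps_const p) (1 + fps_X ^ 2)"
  have id: "ring_morphism (\<lambda>p :: 'k poly. p)" by unfold_locales simp_all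
  show ?thesis
  proof (rule krull_dim_B_ring[OF id])
    show "\<exists>w p. w dvd 1 \<and> w * a = p" for a :: "'k poly" by (rule exI[of _ 1]) simp
    show "ring_morphism ?\<phi>"
      by (rule ring_morphism.ring_morphism_poly_map_poly[OF ring_morphism_fps_const])
    show "\<sigma> poly_z = poly_const 1 * poly_z + poly_const 1"
      by (simp add: assms(2) one_pCons)
    show "?\<phi> (poly_const c) = fps_const c" for c by (simp add: map_poly_pCons)
    show "?\<phi> poly_z = 1 + fps_X ^ 2" by (simp add: map_poly_pCons)
    show "algebra_automorphism poly_const \<sigma>" by (rule assms(1))
  qed simp
qed

text \<open>Here \<open>\<psi>\<close> includes k[z] into the Laurent polynomials, and the units
  clearing denominators are the powers of \<open>laurent_z\<close>.\<close>

lemma krull_dim_B_ring_laurent: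
  fixes \<sigma> :: "'k::{alg_closed_field, field_char_0} laurent \<Rightarrow> 'k laurent"
  assumes "algebra_automorphism laurent_const \<sigma>" "\<sigma> laurent_z = laurent_const \<xi> * laurent_z"
    and "\<xi> \<noteq> 0"
  shows "krull_dim (B_ring laurent_const laurent_z \<sigma> r \<alpha> n) = 1"
proof -
  interpret c: ring_morphism fps_const by (rule ring_morphism_fps_const)
  define \<psi> where "\<psi> = (\<lambda>p. poly (map_poly laurent_const p) (laurent_z :: 'k laurent))"
  have \<psi>: "ring_morphism \<psi>"
    unfolding \<psi>_def
    by (rule ring_morphism.ring_morphism_poly_map_poly[OF ring_morphism_laurent_const])
  interpret \<psi>: ring_morphism \<psi> by (rule \<psi>)
  have \<psi>_const: "\<psi> (poly_const c) = laurent_const c" for c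
    by (simp add: \<psi>_def map_poly_pCons)
  have \<psi>_z: "\<psi> poly_z = laurent_z"
    by (simp add: \<psi>_def map_poly_pCons)
  have z_pow: "laurent_z ^ N = (Poly_Mapping.single (int N) 1 :: 'k laurent)" for N
    by (induction N) (simp_all add: mult_single)
  have loc: "\<exists>N p. laurent_z ^ N * a = \<psi> p" for a
  proof (induction a rule: poly_mapping_single_induct)
    case (single m c)
    \<comment> \<open>Since \<open>nat\<close> truncates at zero, one formula covers both signs: the
      factor on the left is 1 for \<open>m \<ge> 0\<close> and cancels the negative power
      otherwise.\<close>
    have "laurent_z ^ nat (- m) * Poly_Mapping.single m c = \<psi> (poly_const c * poly_z ^ nat m)"
      by (cases "m \<ge> 0") (simp_all add: \<psi>.mult \<psi>.power \<psi>_const \<psi>_z z_pow mult_single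
        del: mult_pCons_left mult_pCons_right)
    then show ?case by blast
  next
    case (add a b)
    then obtain N p N' p' where *: "laurent_z ^ N * a = \<psi> p" "laurent_z ^ N' * b = \<psi> p'" by blast
    have "laurent_z ^ (N + N') * (a + b) =
        laurent_z ^ N' * (laurent_z ^ N * a) + laurent_z ^ N * (laurent_z ^ N' * b)"
      by (simp add: power_add algebra_simps)
    also have "\<dots> = \<psi> (poly_z ^ N' * p + poly_z ^ N * p')"
      by (simp add: * \<psi>.mult \<psi>.add \<psi>.power \<psi>_z)
    finally show ?case by blast
  qed
  have z_unit: "laurent_z ^ N dvd (1 :: 'k laurent)" for N
    by (rule dvdI[of _ _ "Poly_Mapping.single (- int N) 1"]) (simp add: z_pow mult_single)
  \<comment> \<open>the binomial series supplies the negative powers of \<open>1 + t\<^sup>2\<close>\<close>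
  define \<phi> where "\<phi> = pm_eval fps_const (\<lambda>m :: int. fps_binomial (of_int m :: 'k) oo fps_X ^ 2)"
  \<comment> \<open>Binomial series multiply by adding exponents and composition respects products,
    so the second argument of \<open>pm_eval\<close> is a character of \<open>int\<close>.\<close>
  have \<phi>: "ring_morphism \<phi>"
    unfolding \<phi>_def
    by (rule c.ring_morphism_pm_eval)
      (simp_all add: fps_binomial_add_mult fps_compose_mult_distrib)
  have "krull_dim (B_ring (\<lambda>c. \<psi> (poly_const c)) (\<psi> poly_z) \<sigma> r \<alpha> n) = 1"
  proof (rule krull_dim_B_ring[OF \<psi> _ \<phi>])
    show "\<exists>w p. w dvd 1 \<and> w * a = \<psi> p" for a using loc z_unit by blast
    show "\<phi> (\<psi> (poly_const c)) = fps_const c" for c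
      by (simp add: \<phi>_def \<psi>_const c.pm_eval_single)
    show "\<phi> (\<psi> poly_z) = 1 + fps_X ^ 2"
      by (simp add: \<phi>_def \<psi>_z c.pm_eval_single fps_binomial_1 fps_compose_add_distrib)
    show "\<sigma> (\<psi> poly_z) = \<psi> (poly_const \<xi>) * \<psi> poly_z + \<psi> (poly_const 0)"
      by (simp add: assms(2) \<psi>_const \<psi>_z \<psi>.zero)
    show "algebra_automorphism (\<lambda>c. \<psi> (poly_const c)) \<sigma>"
      unfolding \<psi>_const by (rule assms(1))
  qed (rule \<open>\<xi> \<noteq> 0\<close>)
  then show ?thesis by (simp only: \<psi>_const \<psi>_z)
qed

theorem theorem5p8:
  fixes f :: "'k::{alg_closed_field, field_char_0} poly"
    and r :: nat and \<alpha> :: "nat \<Rightarrow> 'k" and n :: "nat \<Rightarrow> nat"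
  assumes monic: "lead_coeff f = 1"
    and roots: "bij_betw \<alpha> {1..r} {x. poly f x = 0}"
    and mult: "\<forall>i\<in>{1..r}. n i = Polynomial.order (\<alpha> i) f"
  shows
    "(\<forall>\<sigma> :: 'k poly \<Rightarrow> 'k poly.
        algebra_automorphism poly_const \<sigma> \<and> \<sigma> poly_z = poly_z + 1 \<and>
        (\<forall>x y. poly f x = 0 \<and> poly f y = 0 \<and> x \<noteq> y \<longrightarrow> \<not> same_orbit (\<lambda>c. c - 1) x y) \<longrightarrow>
        krull_dim (B_ring poly_const poly_z \<sigma> r \<alpha> n) = 1) \<and>
     (\<forall>(\<xi> :: 'k) (\<sigma> :: 'k laurent \<Rightarrow> 'k laurent).
        \<xi> \<noteq> 0 \<and> (\<forall>m::nat. m > 0 \<longrightarrow> \<xi> ^ m \<noteq> 1) \<and> poly f 0 \<noteq> 0 \<and>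
        algebra_automorphism laurent_const \<sigma> \<and> \<sigma> laurent_z = laurent_const \<xi> * laurent_z \<and>
        (\<forall>x y. poly f x = 0 \<and> poly f y = 0 \<and> x \<noteq> y \<longrightarrow>
           \<not> same_orbit (\<lambda>c. inverse \<xi> * c) x y) \<longrightarrow>
        krull_dim (B_ring laurent_const laurent_z \<sigma> r \<alpha> n) = 1)"
  by (intro conjI allI impI; elim conjE)
    (assumption | rule krull_dim_B_ring_poly krull_dim_B_ring_laurent)+

end
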